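(* Consider the multi-criteria problem with feasible set $S$ and real-valued criteria $F_1,\dots,F_n$ (each to be maximized or minimized), and let $K_i$ be the best value of $F_i$ on $S$. If $\vec X_{opt}\in S$ is an optimal solution of the single-criterion problem $$\Delta(\vec X)=\sqrt{\sum_{i=1}^n\,[K_i-F_i(\vec X)]^2}\;\to\;\min\quad\text{over }\vec X\in S,$$ then $\vec X_{opt}$ is a Pareto-optimal solution of the multi-criteria problem.
   Context: Multi-criteria problem: vectors of variables are $\vec X=(x_1,\dots,x_m)$ with $x_k\in X_k$ for given sets $X_k$, subject to restrictions $\varphi_j(\vec X)\le b_j$ for all $j$, where the $\varphi_j$ are real-valued functions and the $b_j$ are real numbers. The feasible set $S$ is the set of all such $\vec X$ satisfying all restrictions. There are $n\ge 1$ real-valued criteria $F_i(\vec X)$, $i\in I=\{1,\dots,n\}$, and for each $i$ it is specified whether $F_i$ is to be maximized or minimized. Best and worst values: if $F_i$ is to be maximized, then $K_i=\max_{S}F_i$ and $W_i=\min_{S}F_i$; if $F_i$ is to be minimized, then $K_i=\min_{S}F_i$ and $W_i=\max_{S}F_i$. Standing assumptions: these extrema exist, and $K_i\ne W_i$ for every $i$. The points $(K_1,\dots,K_n)$ and $(W_1,\dots,W_n)$ of criteria space need not be attained by a feasible vector. Pareto-optimality: $\vec X\in S$ is Pareto-optimal if there is no $\vec X'\in S$ such that, for every $i$, $F_i(\vec X')$ is at least as good as $F_i(\vec X)$ (that is, $\ge$ if $F_i$ is maximized, $\le$ if $F_i$ is minimized), with strict improvement for at least one $i$. *)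

theory Defs
  imports "HOL-Analysis.Analysis"
begin

datatype goal = Maximize | Minimize

(* A vector (x_1, ..., x_m) is an element of the extensional product of the X_k, k = 1..m, so two
   vectors agreeing on 1..m are equal. The X_k share a universe type 'a but are otherwise arbitrary
   sets; J indexes the restrictions. *)
definition feasible_set ::
  "nat \<Rightarrow> (nat \<Rightarrow> 'a set) \<Rightarrow> 'j set \<Rightarrow> ('j \<Rightarrow> (nat \<Rightarrow> 'a) \<Rightarrow> real) \<Rightarrow> ('j \<Rightarrow> real) \<Rightarrow> (nat \<Rightarrow> 'a) set"
where
  "feasible_set m X J \<phi> b = {x \<in> (\<Pi>\<^sub>E k\<in>{1..m}. X k). \<forall>j\<in>J. \<phi> j x \<le> b j}"

definition is_maximum :: "('v \<Rightarrow> real) \<Rightarrow> 'v set \<Rightarrow> real \<Rightarrow> bool" where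
  "is_maximum f S v \<longleftrightarrow> v \<in> f ` S \<and> (\<forall>x\<in>S. f x \<le> v)"

definition is_minimum :: "('v \<Rightarrow> real) \<Rightarrow> 'v set \<Rightarrow> real \<Rightarrow> bool" where
  "is_minimum f S v \<longleftrightarrow> v \<in> f ` S \<and> (\<forall>x\<in>S. v \<le> f x)"

(* Relational, so that asserting the predicate also asserts that the extremum is attained. *)
fun is_best_value :: "goal \<Rightarrow> ('v \<Rightarrow> real) \<Rightarrow> 'v set \<Rightarrow> real \<Rightarrow> bool" where
  "is_best_value Maximize f S v \<longleftrightarrow> is_maximum f S v"
| "is_best_value Minimize f S v \<longleftrightarrow> is_minimum f S v"

fun is_worst_value :: "goal \<Rightarrow> ('v \<Rightarrow> real) \<Rightarrow> 'v set \<Rightarrow> real \<Rightarrow> bool" where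
  "is_worst_value Maximize f S v \<longleftrightarrow> is_minimum f S v"
| "is_worst_value Minimize f S v \<longleftrightarrow> is_maximum f S v"

fun at_least_as_good :: "goal \<Rightarrow> real \<Rightarrow> real \<Rightarrow> bool" where
  "at_least_as_good Maximize u v \<longleftrightarrow> u \<ge> v"
| "at_least_as_good Minimize u v \<longleftrightarrow> u \<le> v"

fun strictly_better :: "goal \<Rightarrow> real \<Rightarrow> real \<Rightarrow> bool" where
  "strictly_better Maximize u v \<longleftrightarrow> u > v"
| "strictly_better Minimize u v \<longleftrightarrow> u < v"

definition pareto_optimal ::
  "nat \<Rightarrow> (nat \<Rightarrow> goal) \<Rightarrow> (nat \<Rightarrow> 'v \<Rightarrow> real) \<Rightarrow> 'v set \<Rightarrow> 'v \<Rightarrow> bool"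
where
  "pareto_optimal n g F S x \<longleftrightarrow> x \<in> S \<and>
     \<not> (\<exists>x'\<in>S. (\<forall>i\<in>{1..n}. at_least_as_good (g i) (F i x') (F i x)) \<and>
               (\<exists>i\<in>{1..n}. strictly_better (g i) (F i x') (F i x)))"

definition deviation :: "nat \<Rightarrow> (nat \<Rightarrow> real) \<Rightarrow> (nat \<Rightarrow> 'v \<Rightarrow> real) \<Rightarrow> 'v \<Rightarrow> real" where
  "deviation n K F x = sqrt (\<Sum>i=1..n. (K i - F i x)\<^sup>2)"

end

theory Submission
  imports Defs
begin

text \<open>
  On the feasible set no criterion value lies beyond the best value. On that side of the best value
  the distance to it is a strictly monotone measure of quality: the better the value, the closer it
  is. So a feasible vector that improves some criterion and worsens none has no larger squared
  distance to the best value in any coordinate (\<open>at_least_as_good_imp_sq_dist_le\<close>) and a smaller one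
  in some coordinate (\<open>strictly_better_imp_sq_dist_less\<close>). Summing, its deviation is strictly
  smaller, so a vector that minimizes the deviation cannot be dominated.
\<close>

lemma at_least_as_good_imp_sq_dist_le:
  assumes "is_best_value d f S k" "x' \<in> S" "at_least_as_good d (f x') (f x)"
  shows "(k - f x')\<^sup>2 \<le> (k - f x)\<^sup>2"
  unfolding abs_le_square_iff[symmetric]
  using assms by (cases d) (force simp: is_maximum_def is_minimum_def)+

lemma strictly_better_imp_sq_dist_less:
  assumes "is_best_value d f S k" "x' \<in> S" "strictly_better d (f x') (f x)"
  shows "(k - f x')\<^sup>2 < (k - f x)\<^sup>2"
proof -
  have "\<bar>k - f x'\<bar> < \<bar>k - f x\<bar>"
    using assms by (cases d) (force simp: is_maximum_def is_minimum_def)+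
  then show ?thesis
    by (simp add: abs_le_square_iff flip: not_le)
qed

text \<open>
  Feasibility keeps the values of the dominating vector \<open>x'\<close> from overshooting the best ones. The
  values of \<open>x\<close> are no better, so they lie on the same side of the best values, at least as far away.
\<close>

lemma deviation_less_if_dominates:
  assumes best: "\<And>i. i \<in> {1..n} \<Longrightarrow> is_best_value (g i) (F i) S (K i)"
    and "x' \<in> S"
    and good: "\<forall>i\<in>{1..n}. at_least_as_good (g i) (F i x') (F i x)"
    and better: "\<exists>i\<in>{1..n}. strictly_better (g i) (F i x') (F i x)"
  shows "deviation n K F x' < deviation n K F x"
proof -
  have "(\<Sum>i=1..n. (K i - F i x')\<^sup>2) < (\<Sum>i=1..n. (K i - F i x)\<^sup>2)"
  proof (rule sum_strict_mono_ex1)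
    show "\<forall>i\<in>{1..n}. (K i - F i x')\<^sup>2 \<le> (K i - F i x)\<^sup>2"
      using at_least_as_good_imp_sq_dist_le[OF best \<open>x' \<in> S\<close>] good by blast
    show "\<exists>i\<in>{1..n}. (K i - F i x')\<^sup>2 < (K i - F i x)\<^sup>2"
      using strictly_better_imp_sq_dist_less[OF best \<open>x' \<in> S\<close>] better by blast
  qed simp
  then show ?thesis
    by (simp add: deviation_def)
qed

theorem theorem1:
  fixes m n :: nat
    and X :: "nat \<Rightarrow> 'a set"
    and J :: "'j set"
    and \<phi> :: "'j \<Rightarrow> (nat \<Rightarrow> 'a) \<Rightarrow> real"
    and b :: "'j \<Rightarrow> real"
    and S :: "(nat \<Rightarrow> 'a) set"
    and g :: "nat \<Rightarrow> goal"
    and F :: "nat \<Rightarrow> (nat \<Rightarrow> 'a) \<Rightarrow> real"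
    and K W :: "nat \<Rightarrow> real"
    and X_opt :: "nat \<Rightarrow> 'a"
  assumes "n \<ge> 1"
    and "S = feasible_set m X J \<phi> b"
    and "\<And>i. i \<in> {1..n} \<Longrightarrow> is_best_value (g i) (F i) S (K i)"
    and "\<And>i. i \<in> {1..n} \<Longrightarrow> is_worst_value (g i) (F i) S (W i)"
    and "\<And>i. i \<in> {1..n} \<Longrightarrow> K i \<noteq> W i"
    and "is_arg_min (deviation n K F) (\<lambda>x. x \<in> S) X_opt"
  shows "pareto_optimal n g F S X_opt"
proof -
  have "\<not> deviation n K F x' < deviation n K F X_opt" if "x' \<in> S" for x'
    using assms(6) that by (auto simp: is_arg_min_def)
  moreover have "X_opt \<in> S"
    using assms(6) by (simp add: is_arg_min_def)
  ultimately show ?thesis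
    unfolding pareto_optimal_def
    using deviation_less_if_dominates[of n g F S K _ X_opt, OF assms(3)] by blast
qed

end
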